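(* Let $f(z)=\sum_{n=1}^\infty a_nz^n$ be a Schwarz function, i.e. $f\in\mathcal{B}$ with $f(0)=0$. Let $\varphi=\{\varphi_n(r)\}_{n=0}^{\infty}\in\mathcal{F}$ and $p\in(0,2]$, define $$\Psi_3(r)=\frac p2\varphi_0(r)-\sum_{n=1}^\infty(n+1)\varphi_n(r),$$ and let $R_3=R_3(p)$ be the minimal positive root in $(0,1)$ of the equation $\Psi_3(r)=0$. If $\Psi_3(r)\ge0$ for $0\le r\le R_3$, then $$C_{f'}(\varphi,p,r):=|a_1|^p\varphi_0(r)+\sum_{n=1}^\infty(n+1)|a_{n+1}|\varphi_n(r)\le\varphi_0(r)\quad\text{for } r\le R_3.$$ Moreover, in the case when $\Psi_3(r)<0$ in some interval $(R_3,R_3+\varepsilon)$ with $\varepsilon>0$, the number $R_3$ cannot be improved.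
   Context: $\mathbb{D}=\{z\in\mathbb{C}:|z|<1\}$. $\mathcal{B}$ is the set of analytic functions $f$ on $\mathbb{D}$ with $\sup_{z\in\mathbb{D}}|f(z)|\le 1$. $\mathcal{F}$ is the set of all sequences $\varphi=\{\varphi_n(r)\}_{n=0}^\infty$ of nonnegative continuous functions on $[0,1)$ such that $\sum_{n=0}^\infty\varphi_n(r)$ converges locally uniformly on $[0,1)$. "The number $R_3$ cannot be improved" means that, for the given $p,\varphi$, $R_3$ cannot be replaced by a larger number: for every $R'\in(R_3,1]$ there exist a Schwarz function $f$ and $r<R'$ such that $C_{f'}(\varphi,p,r)>\varphi_0(r)$. *)

theory Defs
  imports "HOL-Complex_Analysis.Complex_Analysis"
begin

definition unit_ball_class :: "(complex \<Rightarrow> complex) set" where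
  "unit_ball_class = {f. f analytic_on ball 0 1 \<and> (\<forall>z\<in>ball 0 1. norm (f z) \<le> 1)}"

definition schwarz_function :: "(complex \<Rightarrow> complex) \<Rightarrow> bool" where
  "schwarz_function f \<longleftrightarrow> f \<in> unit_ball_class \<and> f 0 = 0"

abbreviation taylor_coeff :: "(complex \<Rightarrow> complex) \<Rightarrow> nat \<Rightarrow> complex" where
  "taylor_coeff f n \<equiv> fps_nth (fps_expansion f 0) n"

definition locally_uniformly_convergent_on ::
    "'a::topological_space set \<Rightarrow> (nat \<Rightarrow> 'a \<Rightarrow> 'b::metric_space) \<Rightarrow> bool" where
  "locally_uniformly_convergent_on S F \<longleftrightarrow>
     (\<forall>x\<in>S. \<exists>U. open U \<and> x \<in> U \<and> uniformly_convergent_on (U \<inter> S) F)"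

definition weight_class :: "(nat \<Rightarrow> real \<Rightarrow> real) set" where
  "weight_class = {\<phi>.
     (\<forall>n. continuous_on {0..<1} (\<phi> n)) \<and>
     (\<forall>n. \<forall>r\<in>{0..<1}. 0 \<le> \<phi> n r) \<and>
     locally_uniformly_convergent_on {0..<1} (\<lambda>N r. \<Sum>n<N. \<phi> n r)}"

(* In the next two definitions the sum over n \<ge> 1 is indexed by Suc n with n \<ge> 0.  Its terms are
   nonnegative on [0,1) and it is taken in the extended reals, because membership in weight_class
   does not make it converge: where it diverges it is \<infinity>, so that Psi3 is -\<infinity> there. *)

definition Psi3 :: "(nat \<Rightarrow> real \<Rightarrow> real) \<Rightarrow> real \<Rightarrow> real \<Rightarrow> ereal" where
  "Psi3 \<phi> p r = ereal (p / 2 * \<phi> 0 r) - (\<Sum>n. ereal ((real (Suc n) + 1) * \<phi> (Suc n) r))"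

definition C_deriv ::
    "(complex \<Rightarrow> complex) \<Rightarrow> (nat \<Rightarrow> real \<Rightarrow> real) \<Rightarrow> real \<Rightarrow> real \<Rightarrow> ereal" where
  "C_deriv f \<phi> p r = ereal (norm (taylor_coeff f 1) powr p * \<phi> 0 r) +
     (\<Sum>n. ereal ((real (Suc n) + 1) * norm (taylor_coeff f (Suc n + 1)) * \<phi> (Suc n) r))"

definition minimal_root :: "(real \<Rightarrow> ereal) \<Rightarrow> real \<Rightarrow> bool" where
  "minimal_root g R \<longleftrightarrow> R \<in> {0<..<1} \<and> g R = 0 \<and> (\<forall>r\<in>{0<..<1}. g r = 0 \<longrightarrow> R \<le> r)"

end

theory Submission
  imports Defs
begin

(* For a fixed leading coefficient a_1, every later Taylor coefficient of a Schwarz function is at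
   most 1 - |a_1|^2: this is Bessel's inequality for f(z) (1 + y z^m) with the optimal y.
   Together with the concavity bound t^(p/2) + (p/2)(1 - t) <= 1 at t = |a_1|^2 it gives the
   estimate up to R_3.  For sharpness take the Schwarz functions z (a - z) / (1 - a z) with a -> 1:
   bounding C_deriv below by a finite partial sum g(a) gives g(1) = phi_0(r) and g'(1) < 0. *)

section \<open>Circle means and comparison of Taylor coefficients\<close>

text \<open>Cauchy's formula for the k-th derivative, rewritten with cnj w = \<rho>^2 / w and dw = 2
  pi i w dt on the circle of radius \<rho>. It turns the mean over the circle into an inner product
  that reads off Taylor coefficients.\<close>

lemma has_integral_circlepath_mult_cnj_power:
  assumes hol: "F holomorphic_on ball 0 1" and F: "F has_fps_expansion P"
    and \<rho>: "0 < \<rho>" "\<rho> < 1"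
  shows "((\<lambda>t. F (circlepath 0 \<rho> t) * cnj (circlepath 0 \<rho> t) ^ k)
            has_integral complex_of_real (\<rho> ^ (2 * k)) * fps_nth P k) {0..1}"
proof -
  have cont: "continuous_on (cball 0 \<rho>) F"
    by (rule holomorphic_on_imp_continuous_on, rule holomorphic_on_subset[OF hol]) (use \<rho> in auto)
  have hol': "F holomorphic_on ball 0 \<rho>"
    by (rule holomorphic_on_subset[OF hol]) (use \<rho> in auto)
  have "((\<lambda>u. F u / (u - 0) ^ Suc k) has_contour_integral
          (2 * pi * \<i>) / fact k * (deriv ^^ k) F 0) (circlepath 0 \<rho>)"
    by (rule Cauchy_has_contour_integral_higher_derivative_circlepath[OF cont hol']) (use \<rho> in auto)
  then have "((\<lambda>t. F (circlepath 0 \<rho> t) / circlepath 0 \<rho> t ^ Suc k *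
               (2 * pi * \<i> * \<rho> * exp (2 * of_real pi * \<i> * t)))
             has_integral (2 * pi * \<i>) / fact k * (deriv ^^ k) F 0) {0..1}"
    unfolding has_contour_integral vector_derivative_circlepath by simp
  \<comment> \<open>This factor cancels 2 pi i and, because \<rho>^2 = w * cnj w, changes w^(-k)
    into (cnj w)^k.\<close>
  then have "((\<lambda>t. complex_of_real (\<rho> ^ (2 * k)) / (2 * pi * \<i>) *
               (F (circlepath 0 \<rho> t) / circlepath 0 \<rho> t ^ Suc k *
               (2 * pi * \<i> * \<rho> * exp (2 * of_real pi * \<i> * t))))
             has_integral complex_of_real (\<rho> ^ (2 * k)) / (2 * pi * \<i>) *
               ((2 * pi * \<i>) / fact k * (deriv ^^ k) F 0)) {0..1}"
    by (rule has_integral_mult_right)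
  moreover have "complex_of_real (\<rho> ^ (2 * k)) / (2 * pi * \<i>) *
               (F (circlepath 0 \<rho> t) / circlepath 0 \<rho> t ^ Suc k *
               (2 * pi * \<i> * \<rho> * exp (2 * of_real pi * \<i> * t)))
      = F (circlepath 0 \<rho> t) * cnj (circlepath 0 \<rho> t) ^ k" for t
  proof -
    define w where "w = circlepath 0 \<rho> t"
    have w: "w = \<rho> * exp (2 * of_real pi * \<i> * t)"
      by (simp add: w_def circlepath)
    have "w \<noteq> 0" using \<rho> by (simp add: w)
    have "norm w = \<rho>" using \<rho> by (simp add: w norm_mult)
    then have "complex_of_real (\<rho>\<^sup>2) = w * cnj w"
      using complex_norm_square by metis
    then have \<rho>k: "complex_of_real (\<rho> ^ (2 * k)) = w ^ k * cnj w ^ k"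
      by (simp add: power_mult power_mult_distrib)
    show ?thesis
      unfolding w_def[symmetric] \<rho>k mult.assoc[of _ "complex_of_real \<rho>"] w[symmetric]
      using \<open>w \<noteq> 0\<close> by (simp add: field_simps)
  qed
  moreover have "complex_of_real (\<rho> ^ (2 * k)) / (2 * pi * \<i>) *
               ((2 * pi * \<i>) / fact k * (deriv ^^ k) F 0)
      = complex_of_real (\<rho> ^ (2 * k)) * fps_nth P k"
    by (simp add: fps_nth_fps_expansion[OF F] field_simps)
  ultimately show ?thesis by simp
qed

lemma has_integral_circlepath_mult_cnj_poly:
  assumes "F holomorphic_on ball 0 1" and "F has_fps_expansion P"
    and "0 < \<rho>" "\<rho> < 1"
  shows "((\<lambda>t. F (circlepath 0 \<rho> t) * cnj (\<Sum>k\<le>n. s k * circlepath 0 \<rho> t ^ k))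
            has_integral (\<Sum>k\<le>n. complex_of_real (\<rho> ^ (2 * k)) * (fps_nth P k * cnj (s k)))) {0..1}"
proof -
  have "((\<lambda>t. \<Sum>k\<le>n. F (circlepath 0 \<rho> t) * cnj (circlepath 0 \<rho> t) ^ k * cnj (s k))
          has_integral (\<Sum>k\<le>n. complex_of_real (\<rho> ^ (2 * k)) * fps_nth P k * cnj (s k))) {0..1}"
    by (intro has_integral_sum has_integral_mult_left has_integral_circlepath_mult_cnj_power assms) auto
  then show ?thesis
    by (simp add: sum_distrib_left mult_ac)
qed

lemma has_fps_expansion_poly_sum:
  fixes q :: "nat \<Rightarrow> complex"
  shows "(\<lambda>z. \<Sum>k\<le>n. q k * z ^ k) has_fps_expansion Abs_fps (\<lambda>k. if k \<le> n then q k else 0)"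
proof -
  have "(\<lambda>z. \<Sum>k\<le>n. q k * z ^ k) has_fps_expansion (\<Sum>k\<le>n. fps_const (q k) * fps_X ^ k)"
    by (induction n) (auto intro!: fps_expansion_intros)
  also have "(\<Sum>k\<le>n. fps_const (q k) * fps_X ^ k) = Abs_fps (\<lambda>k. if k \<le> n then q k else 0)"
    by (rule fps_ext) (auto simp: fps_sum_nth if_distrib cong: if_cong)
  finally show ?thesis .
qed

text \<open>Parseval's identity for a polynomial, obtained by pairing the polynomial with
  itself.\<close>

lemma has_integral_circlepath_norm_poly:
  assumes "0 < \<rho>" "\<rho> < 1"
  shows "((\<lambda>t. (norm (\<Sum>k\<le>n. q k * circlepath 0 \<rho> t ^ k))\<^sup>2)
            has_integral (\<Sum>k\<le>n. \<rho> ^ (2 * k) * (norm (q k))\<^sup>2)) {0..1}"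
proof -
  have "((\<lambda>t. (\<Sum>k\<le>n. q k * circlepath 0 \<rho> t ^ k) * cnj (\<Sum>k\<le>n. q k * circlepath 0 \<rho> t ^ k))
          has_integral (\<Sum>k\<le>n. complex_of_real (\<rho> ^ (2 * k)) *
            (fps_nth (Abs_fps (\<lambda>k. if k \<le> n then q k else 0)) k * cnj (q k)))) {0..1}"
    by (rule has_integral_circlepath_mult_cnj_poly[OF _ has_fps_expansion_poly_sum assms])
       (intro holomorphic_intros)
  then have "((\<lambda>t. complex_of_real ((norm (\<Sum>k\<le>n. q k * circlepath 0 \<rho> t ^ k))\<^sup>2))
          has_integral complex_of_real (\<Sum>k\<le>n. \<rho> ^ (2 * k) * (norm (q k))\<^sup>2)) {0..1}"
    by (simp add: complex_norm_square del: cnj_sum of_real_power)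
  from has_integral_Re[OF this] show ?thesis
    by (simp del: of_real_power of_real_sum)
qed

text \<open>Bessel's inequality. The Taylor polynomial \<open>S\<close> is the orthogonal projection
  of \<open>F\<close> on a circle, so the mean of Re (F * cnj S) equals that of |S|^2. The pointwise
  bound 2 Re (F * cnj S) <= |F|^2 + |S|^2 <= |Q|^2 + |S|^2 then integrates to 2 A <= A + B, without
  ever integrating |F|^2.\<close>

lemma sum_norm_coeff_le:
  assumes hol: "F holomorphic_on ball 0 1" and F: "F has_fps_expansion P"
    and le: "\<And>z. z \<in> ball 0 1 \<Longrightarrow> norm (F z) \<le> norm (\<Sum>k\<le>n. q k * z ^ k)"
  shows "(\<Sum>k\<le>n. (norm (fps_nth P k))\<^sup>2) \<le> (\<Sum>k\<le>n. (norm (q k))\<^sup>2)"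
proof -
  define A where "A = (\<lambda>\<rho>. \<Sum>k\<le>n. \<rho> ^ (2 * k) * (norm (fps_nth P k))\<^sup>2)"
  define B where "B = (\<lambda>\<rho>. \<Sum>k\<le>n. \<rho> ^ (2 * k) * (norm (q k))\<^sup>2)"
  have AB: "A \<rho> \<le> B \<rho>" if \<rho>: "0 < \<rho>" "\<rho> < 1" for \<rho> :: real
  proof -
    define S where "S t = (\<Sum>k\<le>n. fps_nth P k * circlepath 0 \<rho> t ^ k)" for t
    define Q where "Q t = (\<Sum>k\<le>n. q k * circlepath 0 \<rho> t ^ k)" for t
    have "((\<lambda>t. F (circlepath 0 \<rho> t) * cnj (S t)) has_integral
            (\<Sum>k\<le>n. complex_of_real (\<rho> ^ (2 * k)) * (fps_nth P k * cnj (fps_nth P k)))) {0..1}"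
      unfolding S_def by (rule has_integral_circlepath_mult_cnj_poly[OF hol F \<rho>])
    also have "(\<Sum>k\<le>n. complex_of_real (\<rho> ^ (2 * k)) * (fps_nth P k * cnj (fps_nth P k)))
        = complex_of_real (A \<rho>)"
      by (simp add: A_def complex_norm_square del: of_real_power)
    finally have "((\<lambda>t. Re (F (circlepath 0 \<rho> t) * cnj (S t))) has_integral A \<rho>) {0..1}"
      using has_integral_Re by (metis Re_complex_of_real)
    then have 1: "((\<lambda>t. 2 * Re (F (circlepath 0 \<rho> t) * cnj (S t))) has_integral 2 * A \<rho>) {0..1}"
      by (rule has_integral_mult_right)
    have 2: "((\<lambda>t. (norm (S t))\<^sup>2 + (norm (Q t))\<^sup>2) has_integral A \<rho> + B \<rho>) {0..1}"
      unfolding A_def B_def S_def Q_def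
      by (intro has_integral_add has_integral_circlepath_norm_poly \<rho>)
    have "2 * A \<rho> \<le> A \<rho> + B \<rho>"
    proof (rule has_integral_le[OF 1 2])
      fix t :: real
      have "norm (circlepath 0 \<rho> t) = \<rho>"
        using \<rho> by (simp add: circlepath norm_mult)
      then have FQ: "norm (F (circlepath 0 \<rho> t)) \<le> norm (Q t)"
        unfolding Q_def using \<rho> by (intro le) auto
      have "2 * Re (F (circlepath 0 \<rho> t) * cnj (S t)) \<le> 2 * (norm (F (circlepath 0 \<rho> t)) * norm (S t))"
        using complex_Re_le_cmod[of "F (circlepath 0 \<rho> t) * cnj (S t)"] by (simp add: norm_mult)
      also have "\<dots> \<le> (norm (F (circlepath 0 \<rho> t)))\<^sup>2 + (norm (S t))\<^sup>2"
        using sum_squares_bound[of "norm (F (circlepath 0 \<rho> t))" "norm (S t)"] by simp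
      also have "\<dots> \<le> (norm (Q t))\<^sup>2 + (norm (S t))\<^sup>2"
        using FQ by (simp add: power_mono)
      finally show "2 * Re (F (circlepath 0 \<rho> t) * cnj (S t)) \<le> (norm (S t))\<^sup>2 + (norm (Q t))\<^sup>2"
        by simp
    qed
    then show ?thesis by simp
  qed
  \<comment> \<open>\<open>A\<close> and \<open>B\<close> are polynomials in the radius, so the
    inequality survives \<rho> -> 1, where all weights \<rho>^(2k) become 1.\<close>
  have "(A \<longlongrightarrow> A 1) (at_left 1)" "(B \<longlongrightarrow> B 1) (at_left 1)"
    unfolding A_def B_def by (intro tendsto_intros)+
  moreover have "eventually (\<lambda>\<rho>::real. A \<rho> \<le> B \<rho>) (at_left 1)"
    unfolding eventually_at_left_field by (rule exI[of _ 0]) (auto intro: AB)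
  ultimately have "A 1 \<le> B 1"
    by (intro tendsto_le[OF _ \<open>(B \<longlongrightarrow> B 1) (at_left 1)\<close> \<open>(A \<longlongrightarrow> A 1) (at_left 1)\<close>]) auto
  then show ?thesis by (simp add: A_def B_def)
qed

section \<open>Coefficient bounds for Schwarz functions\<close>

text \<open>Since |f| <= 1, the product f(z) (1 + y z^m) is dominated by its polynomial factor, and
  the comparison of coefficients applies. On the left only the indices 1 and m + 1 of the product
  are kept.\<close>

lemma schwarz_coeff_quadratic_bound:
  assumes f: "schwarz_function f" and "m \<ge> 1"
  shows "(norm (taylor_coeff f 1))\<^sup>2 + (norm (taylor_coeff f (m + 1) + taylor_coeff f 1 * y))\<^sup>2
           \<le> 1 + (norm y)\<^sup>2"
proof -
  have hol: "f holomorphic_on ball 0 1" and le1: "\<And>z. z \<in> ball 0 1 \<Longrightarrow> norm (f z) \<le> 1"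
    and f0: "f 0 = 0"
    using f by (auto simp: schwarz_function_def unit_ball_class_def analytic_imp_holomorphic)
  have P: "f has_fps_expansion fps_expansion f 0"
    using hol by (intro has_fps_expansion_fps_expansion[of "ball 0 1"]) auto
  \<comment> \<open>The coefficients of 1 + y z^m, regarded as a polynomial of degree at most m + 1
    so that the comparison reaches index m + 1 of the product.\<close>
  define q where "q k = (if k = 0 then 1 else if k = m then y else 0)" for k
  define G where "G = fps_expansion f 0 * (1 + fps_const y * fps_X ^ m)"
  have sub: "{0, m} \<subseteq> {..m + 1}" by auto
  have q: "(\<Sum>k\<le>m+1. q k * z ^ k) = 1 + y * z ^ m" for z
    using sum.mono_neutral_right[OF finite_atMost sub, of "\<lambda>k. q k * z ^ k"] \<open>m \<ge> 1\<close>
    by (auto simp: q_def)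
  have q2: "(\<Sum>k\<le>m+1. (norm (q k))\<^sup>2) = 1 + (norm y)\<^sup>2"
    using sum.mono_neutral_right[OF finite_atMost sub, of "\<lambda>k. (norm (q k))\<^sup>2"] \<open>m \<ge> 1\<close>
    by (auto simp: q_def)
  have "(\<Sum>k\<le>m+1. (norm (fps_nth G k))\<^sup>2) \<le> (\<Sum>k\<le>m+1. (norm (q k))\<^sup>2)"
  proof (rule sum_norm_coeff_le)
    show "(\<lambda>z. f z * (1 + y * z ^ m)) holomorphic_on ball 0 1"
      by (intro holomorphic_intros hol)
    show "(\<lambda>z. f z * (1 + y * z ^ m)) has_fps_expansion G"
      unfolding G_def by (intro fps_expansion_intros P)
    show "norm (f z * (1 + y * z ^ m)) \<le> norm (\<Sum>k\<le>m+1. q k * z ^ k)" if "z \<in> ball 0 1" for z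
      unfolding q norm_mult using le1[OF that] by (simp add: mult_left_le_one_le)
  qed
  moreover have "(\<Sum>k\<in>{1, m+1}. (norm (fps_nth G k))\<^sup>2) \<le> (\<Sum>k\<le>m+1. (norm (fps_nth G k))\<^sup>2)"
    by (rule sum_mono2) auto
  moreover have nth: "fps_nth G k = taylor_coeff f k + (if k < m then 0 else y * taylor_coeff f (k - m))" for k
    by (simp add: G_def distrib_left fps_X_power_mult_nth mult.commute[of "fps_expansion f 0"] mult.assoc
        distrib_right)
  \<comment> \<open>For m = 1 the coefficient of index 1 in \<open>G\<close> is a_1 + y * a_0, which
    has to reduce to a_1.\<close>
  moreover have "taylor_coeff f 0 = 0"
    using f0 by (simp add: fps_expansion_def)
  ultimately show ?thesis
    using \<open>m \<ge> 1\<close> q2 by (cases "m = 1") (auto simp: mult.commute)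
qed

text \<open>The quadratic bound holds for every y. Taking y = 0 gives the first claim, and the
  second comes from optimising y.\<close>

lemma schwarz_coeff_bounds:
  assumes f: "schwarz_function f" and m: "m \<ge> 1"
  shows "norm (taylor_coeff f 1) \<le> 1"
    and "norm (taylor_coeff f (m + 1)) \<le> 1 - (norm (taylor_coeff f 1))\<^sup>2"
proof -
  define \<beta> \<gamma> where "\<beta> = norm (taylor_coeff f 1)" and "\<gamma> = norm (taylor_coeff f (m + 1))"
  have nn: "0 \<le> \<beta>" "0 \<le> \<gamma>" by (auto simp: \<beta>_def \<gamma>_def)
  have *: "\<beta>\<^sup>2 + (\<gamma> * (1 + t * \<beta>\<^sup>2))\<^sup>2 \<le> 1 + (t * \<gamma> * \<beta>)\<^sup>2" if "t \<ge> 0" for t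
  proof -
    \<comment> \<open>This phase makes a_1 * y a nonnegative multiple of a_(m+1), so the moduli add
      up; only the real parameter t is left to choose.\<close>
    define y where "y = of_real t * taylor_coeff f (m + 1) * cnj (taylor_coeff f 1)"
    have "taylor_coeff f (m + 1) + taylor_coeff f 1 * y
        = taylor_coeff f (m + 1) * of_real (1 + t * \<beta>\<^sup>2)"
      unfolding y_def \<beta>_def of_real_add of_real_mult complex_norm_square by (simp add: algebra_simps)
    moreover have "0 \<le> 1 + t * \<beta>\<^sup>2" using that by simp
    ultimately have "norm (taylor_coeff f (m + 1) + taylor_coeff f 1 * y) = \<gamma> * (1 + t * \<beta>\<^sup>2)"
      by (simp only: norm_mult norm_of_real \<gamma>_def abs_of_nonneg)
    moreover have "norm y = t * \<gamma> * \<beta>"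
      using that by (simp add: y_def norm_mult \<beta>_def \<gamma>_def)
    ultimately show ?thesis
      using schwarz_coeff_quadratic_bound[OF f m, of y] by (simp add: \<beta>_def)
  qed
  have 0: "\<beta>\<^sup>2 + \<gamma>\<^sup>2 \<le> 1" using *[of 0] by simp
  then have "\<beta>\<^sup>2 \<le> 1\<^sup>2" using zero_le_power2[of \<gamma>] unfolding one_power2 by linarith
  then show "norm (taylor_coeff f 1) \<le> 1"
    unfolding \<beta>_def[symmetric] by (rule power2_le_imp_le) simp
  have "\<gamma> \<le> 1 - \<beta>\<^sup>2"
  \<comment> \<open>The optimal t is 1 / (1 - \<beta>^2). If \<beta> = 1 it does not exist, but then
    t = 0 already forces \<gamma> = 0.\<close>
  proof (cases "\<beta>\<^sup>2 = 1")
    case True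
    with 0 show ?thesis using nn by simp
  next
    case False
    define D where "D = 1 - \<beta>\<^sup>2"
    have D: "D > 0" using False \<open>\<beta>\<^sup>2 \<le> 1\<^sup>2\<close> by (simp add: D_def)
    have b: "\<beta>\<^sup>2 = 1 - D" by (simp add: D_def)
    \<comment> \<open>At t = 1 / D the factor 1 + t * \<beta>^2 equals t itself, so both squares
      become multiples of (\<gamma> / D)^2 and a common factor D cancels.\<close>
    have "1 + 1 / D * \<beta>\<^sup>2 = 1 / D" using D by (simp add: b field_simps)
    then have "\<beta>\<^sup>2 + (\<gamma> / D)\<^sup>2 \<le> 1 + (\<gamma> / D)\<^sup>2 * \<beta>\<^sup>2"
      using *[of "1 / D"] D by (simp add: power_mult_distrib power_divide)
    then have "(\<gamma> / D)\<^sup>2 * D \<le> 1 * D" by (simp add: b algebra_simps)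
    then have "(\<gamma> / D)\<^sup>2 \<le> 1\<^sup>2" using D by simp
    then have "\<gamma> / D \<le> 1" by (rule power2_le_imp_le) simp
    then show ?thesis using D by (simp add: D_def)
  qed
  then show "norm (taylor_coeff f (m + 1)) \<le> 1 - (norm (taylor_coeff f 1))\<^sup>2"
    by (simp add: \<beta>_def \<gamma>_def)
qed

section \<open>The estimate where \<open>Psi3\<close> is nonnegative\<close>

text \<open>Weighted AM-GM for \<beta>^2 and 1 with weights p/2 and 1 - p/2; here p <= 2 enters. For
  \<beta> = 0 the power is 0 and the claim reduces to p/2 <= 1.\<close>

lemma powr_le_one_minus:
  fixes \<beta> p :: real
  assumes "0 \<le> \<beta>" "0 < p" "p \<le> 2"
  shows "\<beta> powr p + p / 2 * (1 - \<beta>\<^sup>2) \<le> 1"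
proof (cases "\<beta> = 0")
  case False
  have "(\<beta>\<^sup>2) powr (p / 2) * 1 powr (1 - p / 2) \<le> p / 2 * \<beta>\<^sup>2 + (1 - p / 2) * 1"
    by (rule Youngs_inequality_0) (use assms False in auto)
  moreover have "(\<beta>\<^sup>2) powr (p / 2) = \<beta> powr p"
    using assms False by (simp add: powr_powr flip: powr_numeral)
  ultimately show ?thesis by (simp add: algebra_simps)
qed (use assms in auto)

text \<open>Replacing every later coefficient by its bound 1 - \<beta>^2 turns the series into a
  multiple of the one in \<open>Psi3\<close>, which leaves (\<beta>^p + (p/2)(1 - \<beta>^2)) times
  the weight of index 0.\<close>

lemma C_deriv_le:
  assumes \<phi>: "\<And>n. 0 \<le> \<phi> n r" and p: "0 < p" "p \<le> 2"
    and Psi: "0 \<le> Psi3 \<phi> p r" and f: "schwarz_function f"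
  shows "C_deriv f \<phi> p r \<le> ereal (\<phi> 0 r)"
proof -
  define \<beta> where "\<beta> = norm (taylor_coeff f 1)"
  have \<beta>: "0 \<le> \<beta>" "\<beta> \<le> 1"
    using schwarz_coeff_bounds(1)[OF f order.refl] by (auto simp: \<beta>_def)
  then have \<beta>2: "0 \<le> 1 - \<beta>\<^sup>2" by (simp add: power_le_one)
  define T where "T = (\<Sum>n. ereal ((real (Suc n) + 1) * \<phi> (Suc n) r))"
  \<comment> \<open>An infinite \<open>T\<close> would make \<open>Psi3\<close> equal to minus
    infinity, so the hypothesis also yields convergence.\<close>
  have T: "T \<le> ereal (p / 2 * \<phi> 0 r)"
    using Psi unfolding Psi3_def T_def[symmetric] by (cases T) auto
  have "(\<Sum>n. ereal ((real (Suc n) + 1) * norm (taylor_coeff f (Suc n + 1)) * \<phi> (Suc n) r))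
      \<le> (\<Sum>n. ereal (1 - \<beta>\<^sup>2) * ereal ((real (Suc n) + 1) * \<phi> (Suc n) r))"
  proof (rule suminf_le_pos)
    fix n
    show "0 \<le> ereal ((real (Suc n) + 1) * norm (taylor_coeff f (Suc n + 1)) * \<phi> (Suc n) r)"
      using \<phi> by simp
    have "norm (taylor_coeff f (Suc n + 1)) * ((real (Suc n) + 1) * \<phi> (Suc n) r)
       \<le> (1 - \<beta>\<^sup>2) * ((real (Suc n) + 1) * \<phi> (Suc n) r)"
      unfolding \<beta>_def using \<phi> by (intro mult_right_mono schwarz_coeff_bounds(2)[OF f]) auto
    then show "ereal ((real (Suc n) + 1) * norm (taylor_coeff f (Suc n + 1)) * \<phi> (Suc n) r)
      \<le> ereal (1 - \<beta>\<^sup>2) * ereal ((real (Suc n) + 1) * \<phi> (Suc n) r)"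
      by (simp add: mult_ac)
  qed
  also have "\<dots> = ereal (1 - \<beta>\<^sup>2) * T"
    unfolding T_def by (rule suminf_cmult_ereal) (use \<phi> \<beta>2 in auto)
  also have "\<dots> \<le> ereal (1 - \<beta>\<^sup>2) * ereal (p / 2 * \<phi> 0 r)"
    by (rule ereal_mult_left_mono[OF T]) (use \<beta>2 in auto)
  finally have "C_deriv f \<phi> p r \<le> ereal (\<beta> powr p * \<phi> 0 r) + ereal (1 - \<beta>\<^sup>2) * ereal (p / 2 * \<phi> 0 r)"
    unfolding C_deriv_def \<beta>_def by (rule add_left_mono)
  also have "\<dots> = ereal ((\<beta> powr p + p / 2 * (1 - \<beta>\<^sup>2)) * \<phi> 0 r)"
    by (simp add: algebra_simps diff_divide_distrib)
  also have "\<dots> \<le> ereal (\<phi> 0 r)"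
    using mult_right_mono[OF powr_le_one_minus[OF \<beta>(1) p] \<phi>[of 0]] by simp
  finally show ?thesis .
qed

section \<open>Extremal functions and sharpness\<close>

text \<open>For |a| < 1 this is a Blaschke product of degree two. For 0 < a < 1 its later
  coefficients have modulus (1 - a^2) a^n, so as a -> 1 each of them asymptotically attains the
  bound 1 - a_1^2.\<close>

definition blaschke_schwarz :: "real \<Rightarrow> complex \<Rightarrow> complex" where
  "blaschke_schwarz a z = z * (of_real a - z) / (1 - of_real a * z)"

text \<open>The difference of the squared moduli factors as (1 - a^2)(1 - |z|^2).\<close>

lemma norm_diff_le_norm_one_minus:
  fixes z :: complex
  assumes a: "\<bar>a\<bar> < 1" and z: "norm z < 1"
  shows "norm (of_real a - z) \<le> norm (1 - of_real a * z)"
proof -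
  have "(norm (1 - of_real a * z))\<^sup>2 - (norm (of_real a - z))\<^sup>2 = (1 - a\<^sup>2) * (1 - (norm z)\<^sup>2)"
    unfolding cmod_power2 by (simp add: power2_eq_square algebra_simps)
  moreover have "a\<^sup>2 < 1" "(norm z)\<^sup>2 < 1"
    using a z by (auto simp: abs_square_less_1)
  ultimately have "(norm (of_real a - z))\<^sup>2 \<le> (norm (1 - of_real a * z))\<^sup>2"
    by (metis diff_ge_0_iff_ge less_imp_le mult_nonneg_nonneg)
  then show ?thesis by (rule power2_le_imp_le) simp
qed

lemma schwarz_function_blaschke:
  assumes a: "\<bar>a\<bar> < 1"
  shows "schwarz_function (blaschke_schwarz a)"
proof -
  have nz: "1 - of_real a * z \<noteq> 0" if "norm z < 1" for z :: complex
  proof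
    assume "1 - of_real a * z = 0"
    then have "norm (of_real a * z) = 1" by simp
    moreover have "norm (of_real a * z) < 1"
      using mult_strict_mono'[OF a that] by (simp add: norm_mult)
    ultimately show False by simp
  qed
  have "blaschke_schwarz a holomorphic_on ball 0 1"
    unfolding blaschke_schwarz_def by (intro holomorphic_intros) (use nz in auto)
  moreover have "norm (blaschke_schwarz a z) \<le> 1" if z: "norm z < 1" for z
  proof -
    have "norm z * norm (of_real a - z) \<le> 1 * norm (1 - of_real a * z)"
      using z norm_diff_le_norm_one_minus[OF a z] by (intro mult_mono) auto
    then show ?thesis
      using nz[OF z] by (simp add: blaschke_schwarz_def norm_mult norm_divide)
  qed
  ultimately show ?thesis
    by (auto simp: schwarz_function_def unit_ball_class_def analytic_on_open blaschke_schwarz_def)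
qed

lemma taylor_coeff_blaschke:
  assumes a: "\<bar>a\<bar> < 1"
  shows "taylor_coeff (blaschke_schwarz a) 1 = of_real a"
    and "taylor_coeff (blaschke_schwarz a) (n + 2) = - of_real ((1 - a\<^sup>2) * a ^ n)"
proof -
  define P where "P = fps_expansion (blaschke_schwarz a) 0"
  have "blaschke_schwarz a holomorphic_on ball 0 1"
    using schwarz_function_blaschke[OF a]
    by (auto simp: schwarz_function_def unit_ball_class_def analytic_imp_holomorphic)
  then have P: "blaschke_schwarz a has_fps_expansion P"
    unfolding P_def by (intro has_fps_expansion_fps_expansion[of "ball 0 1"]) auto
  define c where "c = complex_of_real a"
  have Q: "blaschke_schwarz a has_fps_expansion fps_X * (fps_const c - fps_X) / (1 - fps_const c * fps_X)"
    unfolding blaschke_schwarz_def[abs_def] c_def[symmetric]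
    by (intro fps_expansion_intros) auto
  \<comment> \<open>Both series expand the same function, so their coefficients are the same
    derivatives at 0.\<close>
  have "P = fps_X * (fps_const c - fps_X) / (1 - fps_const c * fps_X)"
    by (rule fps_ext) (simp add: fps_nth_fps_expansion[OF P] fps_nth_fps_expansion[OF Q])
  then have "P * (1 - fps_const c * fps_X) = fps_X * (fps_const c - fps_X)"
    by (simp add: fps_divide_unit mult.assoc inverse_mult_eq_1)
  \<comment> \<open>Clearing the denominator and keeping \<open>P\<close> on both sides gives a
    recursion that is geometric with ratio c from index 2 on.\<close>
  then have eq: "P = fps_X * (fps_const c - fps_X) + fps_const c * (fps_X * P)"
    by (simp add: algebra_simps)
  have rec: "fps_nth P k = fps_nth (fps_X * (fps_const c - fps_X)) k
      + c * (if k = 0 then 0 else fps_nth P (k - 1))" for k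
    by (subst eq) simp
  have P0: "fps_nth P 0 = 0" using rec[of 0] by simp
  have P1: "fps_nth P 1 = c" using rec[of 1] P0 by simp
  show "taylor_coeff (blaschke_schwarz a) 1 = of_real a"
    using P1 by (simp add: P_def c_def)
  have "fps_nth P (n + 2) = - (1 - c\<^sup>2) * c ^ n"
  proof (induction n)
    case 0
    show ?case using rec[of 2] P1 by (simp add: power2_eq_square numeral_2_eq_2)
  next
    case (Suc n)
    have "fps_nth P (Suc n + 2) = c * fps_nth P (n + 2)"
      using rec[of "Suc n + 2"] by simp
    then show ?case unfolding Suc by (simp add: mult_ac)
  qed
  then show "taylor_coeff (blaschke_schwarz a) (n + 2) = - of_real ((1 - a\<^sup>2) * a ^ n)"
    by (simp add: P_def c_def algebra_simps)
qed

lemma exists_C_deriv_gt: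
  assumes \<phi>: "\<And>n. 0 \<le> \<phi> n r" and Psi: "Psi3 \<phi> p r < 0"
  shows "\<exists>f. schwarz_function f \<and> C_deriv f \<phi> p r > ereal (\<phi> 0 r)"
proof -
  define w where "w n = (real (Suc n) + 1) * \<phi> (Suc n) r" for n
  have w: "0 \<le> w n" for n using \<phi> by (simp add: w_def)
  have "ereal (p / 2 * \<phi> 0 r) < (\<Sum>n. ereal (w n))"
    using Psi unfolding Psi3_def w_def by (cases "\<Sum>n. ereal (w n)") (auto simp: w_def)
  \<comment> \<open>A nonnegative series is the supremum of its partial sums even when it diverges,
    so some finite sum already exceeds the left side and g below is differentiable at 1.\<close>
  also have "(\<Sum>n. ereal (w n)) = (SUP N. \<Sum>n<N. ereal (w n))"
    by (rule suminf_ereal_eq_SUP) (use w in auto)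
  finally obtain N where "ereal (p / 2 * \<phi> 0 r) < (\<Sum>n<N. ereal (w n))"
    unfolding less_SUP_iff by blast
  then have N: "p / 2 * \<phi> 0 r < (\<Sum>n<N. w n)" by simp
  \<comment> \<open>For 0 < a < 1 this is \<open>C_deriv\<close> of
    \<open>blaschke_schwarz a\<close> with the series cut off after N terms.\<close>
  define g where "g a = a powr p * \<phi> 0 r + (1 - a\<^sup>2) * (\<Sum>n<N. a ^ n * w n)" for a :: real
  \<comment> \<open>The 2 is minus the derivative of 1 - a^2 at 1; it matches the p/2 in
    \<open>Psi3\<close>, so the choice of N makes this derivative negative.\<close>
  have "(g has_real_derivative p * \<phi> 0 r - 2 * (\<Sum>n<N. w n)) (at 1)"
    unfolding g_def by (auto intro!: derivative_eq_intros)
  then obtain d where d: "d > 0" "\<And>h. 0 < h \<Longrightarrow> h < d \<Longrightarrow> g 1 < g (1 - h)"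
    using DERIV_neg_dec_left[of g "p * \<phi> 0 r - 2 * (\<Sum>n<N. w n)" 1] N by auto
  \<comment> \<open>Within d of 1 for the increase of g, and at least 1/2 so that a is positive and
    equals its own modulus.\<close>
  define a where "a = 1 - min (1/2) (d / 2)"
  have a: "0 < a" "a < 1" and "g 1 < g a"
    using d(1) d(2)[of "min (1/2) (d / 2)"] by (auto simp: a_def)
  then have a1: "\<bar>a\<bar> < 1" "a\<^sup>2 \<le> 1" by (auto simp: power_le_one)
  have "ereal (\<phi> 0 r) < ereal (g a)" using \<open>g 1 < g a\<close> by (simp add: g_def)
  also have "ereal (g a) = ereal (a powr p * \<phi> 0 r) + (\<Sum>n<N. ereal ((1 - a\<^sup>2) * (a ^ n * w n)))"
    by (simp add: g_def sum_distrib_left)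
  also have "\<dots> \<le> ereal (a powr p * \<phi> 0 r) + (\<Sum>n. ereal ((1 - a\<^sup>2) * (a ^ n * w n)))"
    using a a1 w
    by (intro add_left_mono sum_le_suminf summable_ereal_pos) auto
  also have "(\<lambda>n. ereal ((1 - a\<^sup>2) * (a ^ n * w n))) = (\<lambda>n. ereal ((real (Suc n) + 1) *
      norm (taylor_coeff (blaschke_schwarz a) (Suc n + 1)) * \<phi> (Suc n) r))"
  proof
    fix n
    have "norm (taylor_coeff (blaschke_schwarz a) (Suc n + 1)) = (1 - a\<^sup>2) * a ^ n"
      using taylor_coeff_blaschke(2)[OF a1(1), of n] a a1
      by (simp add: norm_mult del: of_real_diff of_real_power)
    then show "ereal ((1 - a\<^sup>2) * (a ^ n * w n)) = ereal ((real (Suc n) + 1) *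
      norm (taylor_coeff (blaschke_schwarz a) (Suc n + 1)) * \<phi> (Suc n) r)"
      by (simp add: w_def mult_ac)
  qed
  also have "ereal (a powr p * \<phi> 0 r) + (\<Sum>n. ereal ((real (Suc n) + 1) *
      norm (taylor_coeff (blaschke_schwarz a) (Suc n + 1)) * \<phi> (Suc n) r))
      = C_deriv (blaschke_schwarz a) \<phi> p r"
    unfolding C_deriv_def taylor_coeff_blaschke(1)[OF a1(1)] using a by simp
  finally show ?thesis
    using schwarz_function_blaschke[OF a1(1)] by blast
qed

theorem theorem3:
  fixes \<phi> :: "nat \<Rightarrow> real \<Rightarrow> real" and p R\<^sub>3 :: real
  assumes "\<phi> \<in> weight_class"
    and "0 < p" and "p \<le> 2"
    and "minimal_root (Psi3 \<phi> p) R\<^sub>3"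
  shows "((\<forall>r\<in>{0..R\<^sub>3}. 0 \<le> Psi3 \<phi> p r) \<longrightarrow>
           (\<forall>f. schwarz_function f \<longrightarrow> (\<forall>r\<in>{0..R\<^sub>3}. C_deriv f \<phi> p r \<le> ereal (\<phi> 0 r)))) \<and>
         ((\<exists>\<epsilon>>0. R\<^sub>3 + \<epsilon> \<le> 1 \<and> (\<forall>r\<in>{R\<^sub>3<..<R\<^sub>3 + \<epsilon>}. Psi3 \<phi> p r < 0)) \<longrightarrow>
           (\<forall>R'\<in>{R\<^sub>3<..1}. \<exists>f r. schwarz_function f \<and> 0 \<le> r \<and> r < R' \<and>
              C_deriv f \<phi> p r > ereal (\<phi> 0 r)))"
proof (intro conjI impI allI ballI)
  have R: "0 < R\<^sub>3" "R\<^sub>3 < 1"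
    using assms(4) by (auto simp: minimal_root_def)
  have \<phi>: "0 \<le> \<phi> n r" if "0 \<le> r" "r < 1" for n r
    using assms(1) that by (auto simp: weight_class_def)
  show "C_deriv f \<phi> p r \<le> ereal (\<phi> 0 r)"
    if "\<forall>r\<in>{0..R\<^sub>3}. 0 \<le> Psi3 \<phi> p r" "schwarz_function f" "r \<in> {0..R\<^sub>3}" for f r
    using that R assms(2,3) by (intro C_deriv_le \<phi>) auto
  show "\<exists>f r. schwarz_function f \<and> 0 \<le> r \<and> r < R' \<and> C_deriv f \<phi> p r > ereal (\<phi> 0 r)"
    if neg: "\<exists>\<epsilon>>0. R\<^sub>3 + \<epsilon> \<le> 1 \<and> (\<forall>r\<in>{R\<^sub>3<..<R\<^sub>3 + \<epsilon>}. Psi3 \<phi> p r < 0)"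
      and R': "R' \<in> {R\<^sub>3<..1}" for R'
  proof -
    obtain \<epsilon> where \<epsilon>: "\<epsilon> > 0" "\<forall>r\<in>{R\<^sub>3<..<R\<^sub>3 + \<epsilon>}. Psi3 \<phi> p r < 0"
      using neg by blast
    \<comment> \<open>A radius beyond \<open>R\<^sub>3\<close> where \<open>Psi3\<close> is
      negative, yet below R', hence below 1, where the weights are nonnegative.\<close>
    obtain r where r: "R\<^sub>3 < r" "r < min R' (R\<^sub>3 + \<epsilon>)"
      using dense[of "R\<^sub>3" "min R' (R\<^sub>3 + \<epsilon>)"] R' \<epsilon>(1) by auto
    have "0 \<le> r" "r < 1" using r R R' by auto
    then have "\<exists>f. schwarz_function f \<and> C_deriv f \<phi> p r > ereal (\<phi> 0 r)"
      using r by (intro exists_C_deriv_gt \<phi> bspec[OF \<epsilon>(2)]) auto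
    then show ?thesis using r \<open>0 \<le> r\<close> by auto
  qed
qed

end
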